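(* Let $\varphi$ be an elliptic automorphism of $\mathbb{D}$ (different from the identity) with Denjoy-Wolff point $p$ and let $\lambda=\varphi'(p)$. Let $\psi$ be an arbitrary linear fractional self-map of $\mathbb{D}$. Suppose $f$ is a non-constant self-map of $\mathbb{D}$ such that $f\circ\varphi=\psi\circ f$ and define $n_0=\min\{n\in\mathbb{N}: f^{(n)}(p)\neq0\}$. (i) If $\psi$ is the identity map and $m_0=\min\{n\ge1:\lambda^n=1\}$, then there is a non-constant self-map $g$ of $\mathbb{D}$, with $g(0)=0$, such that $$(\varphi_{f(p)}\circ f\circ\varphi_p)(z)=g(z^{m_0}),\quad z\in\mathbb{D}.$$ Moreover, the function $f$ is never a linear fractional map. (ii) Assume $\psi$ is not the identity map, $q$ is its Denjoy-Wolff point, and $\mu=\psi'(q)$. Then $\lambda^{n_0}=\mu$. Also, the following dichotomy takes place: (a) If $\lambda^n\neq1$ for every positive integer $n$, then there exists a point $\beta\in\overline{\mathbb{D}}\setminus\{0\}$ such that $(\varphi_q\circ f\circ\varphi_p)(z)=\beta z^{n_0}$ for all $z\in\mathbb{D}$. In particular, $f$ is a linear fractional map if and only if $n_0=1$. (b) If $\lambda^n=1$ for some positive integer $n$, and $m_0=\min\{n\ge1:\lambda^n=1\}$, then there exists a non-zero self-map $g$ of $\mathbb{D}$ such that $$(\varphi_q\circ f\circ\varphi_p)(z)=z^{n_0}g(z^{m_0}),\quad z\in\mathbb{D}.$$ In particular, $f$ is a linear fractional map if and only if $g$ is constant and $n_0=1$.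
   Context: $\mathbb{D}$ is the open unit disk in $\mathbb{C}$ and $\mathbb{N}$ is the set of positive integers. A self-map of $\mathbb{D}$ is a function $f$ analytic in $\mathbb{D}$ with $f(\mathbb{D})\subset\mathbb{D}$. A linear fractional map is a map of the form $z\mapsto (az+b)/(cz+d)$ with $ad-bc\ne0$. An automorphism is a bijective self-map of $\mathbb{D}$. A non-identity self-map is elliptic if it has a (necessarily unique) fixed point in $\mathbb{D}$; this point is then called its Denjoy-Wolff point (also for automorphisms). If a non-identity self-map has no fixed point in $\mathbb{D}$, its Denjoy-Wolff point is the unique point of $\partial\mathbb{D}$ to which its iterates converge uniformly on compact subsets of $\mathbb{D}$. For $a\in\mathbb{D}$, $\varphi_a(z)=\dfrac{a-z}{1-\overline{a}z}$. (Under the hypotheses of (ii), $\psi$ is necessarily elliptic with $q=f(p)\in\mathbb{D}$, so $\varphi_q$ is defined.)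
   Formalization: In (ii)(b), g is a non-zero self-map of the disk or a constant of modulus 1; the latter must be allowed, since for φ(z)=ψ(z)=−z and f(z)=z one is forced to have g=1, which does not map into the open disk. *)

theory Defs
  imports "HOL-Complex_Analysis.Complex_Analysis"
begin

text \<open>
  Maps of the open unit disk are represented by total functions on the complex numbers;
  only their values on \<open>unit_disk\<close> are ever constrained or used.
\<close>

abbreviation unit_disk :: "complex set" where
  "unit_disk \<equiv> ball 0 1"

definition disk_self_map :: "(complex \<Rightarrow> complex) \<Rightarrow> bool" where
  "disk_self_map f \<longleftrightarrow> f holomorphic_on unit_disk \<and> f ` unit_disk \<subseteq> unit_disk"

definition disk_identity :: "(complex \<Rightarrow> complex) \<Rightarrow> bool" where
  "disk_identity f \<longleftrightarrow> (\<forall>z\<in>unit_disk. f z = z)"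

definition disk_automorphism :: "(complex \<Rightarrow> complex) \<Rightarrow> bool" where
  "disk_automorphism f \<longleftrightarrow> disk_self_map f \<and> bij_betw f unit_disk unit_disk"

text \<open>
  The condition on the denominator says that the pole, if any, lies outside the disk;
  without it, the convention \<open>x / 0 = 0\<close> would assign a spurious value at the pole.
\<close>

definition linear_fractional :: "(complex \<Rightarrow> complex) \<Rightarrow> bool" where
  "linear_fractional f \<longleftrightarrow>
     (\<exists>a b c d. a * d - b * c \<noteq> 0 \<and>
        (\<forall>z\<in>unit_disk. c * z + d \<noteq> 0 \<and> f z = (a * z + b) / (c * z + d)))"

definition elliptic :: "(complex \<Rightarrow> complex) \<Rightarrow> bool" where
  "elliptic f \<longleftrightarrow>
     disk_self_map f \<and> \<not> disk_identity f \<and> (\<exists>z\<in>unit_disk. f z = z)"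

definition denjoy_wolff_point :: "(complex \<Rightarrow> complex) \<Rightarrow> complex \<Rightarrow> bool" where
  "denjoy_wolff_point f w \<longleftrightarrow>
     disk_self_map f \<and> \<not> disk_identity f \<and>
     (if elliptic f then w \<in> unit_disk \<and> f w = w
      else w \<in> sphere 0 1 \<and>
        (\<forall>K. compact K \<and> K \<subseteq> unit_disk \<longrightarrow>
           uniform_limit K (\<lambda>n. f ^^ n) (\<lambda>_. w) sequentially))"

definition disk_involution :: "complex \<Rightarrow> complex \<Rightarrow> complex" where
  "disk_involution a z = (a - z) / (1 - cnj a * z)"

end

theory Submission imports Defs begin

text \<open>
  Write \<open>\<phi>\<^sub>a\<close> for the disk involution that exchanges \<open>0\<close> and \<open>a\<close>. Conjugating by these
  involutions moves the fixed points to the origin, where the Schwarz lemma recognizes rotations.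
  An automorphism fixing \<open>p\<close> becomes the rotation \<open>z \<mapsto> \<lambda>z\<close> with \<open>\<bar>\<lambda>\<bar> = 1\<close>
  (\<open>automorphism_is_rotation\<close>), and \<open>\<lambda> \<noteq> 1\<close> because the automorphism is not the identity.
  Since \<open>\<psi> (f p) = f (\<phi> p) = f p\<close>, the map \<open>\<psi>\<close> also has a fixed point in the disk; a
  non-identity self-map has at most one (\<open>unique_fixed_point\<close>), so \<open>q = f p\<close> in the second part.
  With \<open>q = f p\<close>, \<open>F = \<phi>\<^sub>q \<circ> f \<circ> \<phi>\<^sub>p\<close> and \<open>\<Psi> = \<phi>\<^sub>q \<circ> \<psi> \<circ> \<phi>\<^sub>q\<close> both fix the origin, and the
  functional equation reads \<open>F (\<lambda>z) = \<Psi> (F z)\<close>.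

  The involutions are conformal, so \<open>F\<close> vanishes at \<open>0\<close> to the order \<open>n\<^sub>0\<close> to which \<open>f\<close> takes its
  value at \<open>p\<close>: \<open>F z = z ^ n\<^sub>0 * H z\<close> with \<open>H 0 \<noteq> 0\<close> (\<open>conjugate_order_factorization\<close>).
  Comparing the leading coefficients on both sides of the functional equation gives
  \<open>\<lambda> ^ n\<^sub>0 = \<Psi>' 0 = \<mu>\<close> (\<open>semiconjugacy_multiplier\<close>). Hence \<open>\<bar>\<mu>\<bar> = 1\<close>, and the equality case of the
  Schwarz lemma forces \<open>\<Psi>\<close> to be the rotation by \<open>\<mu>\<close>, so that \<open>\<psi>\<close> turns out to be an
  automorphism. The equation becomes \<open>F (\<lambda>z) = \<lambda> ^ n\<^sub>0 * F z\<close>, which says that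
  \<open>H (\<lambda>z) = H z\<close>. When \<open>\<psi>\<close> is the identity, \<open>F\<close> itself is invariant under the rotation.

  A holomorphic function invariant under \<open>z \<mapsto> \<lambda>z\<close> has a non-zero \<open>n\<close>-th Taylor coefficient only if
  \<open>\<lambda> ^ n = 1\<close>. So it is constant if \<open>\<lambda>\<close> is not a root of unity, and a function of \<open>z ^ m\<^sub>0\<close> if
  \<open>m\<^sub>0\<close> is the order of \<open>\<lambda>\<close> (\<open>rotation_invariant_factors_through_power\<close>). The bound
  \<open>\<bar>H\<bar> \<le> 1\<close>, from the maximum principle, completes the description of \<open>F\<close>.

  Finally, \<open>f\<close> is linear fractional exactly if \<open>F\<close> is. The derivative of such a map never vanishes,
  which excludes the first part (there \<open>F' 0 = 0\<close>) and gives \<open>n\<^sub>0 = 1\<close> in the second; and a linear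
  fractional map that fixes \<open>0\<close> and commutes with a non-trivial rotation is linear, so that \<open>H\<close>
  is constant.
\<close>

section \<open>The disk involutions\<close>

text \<open>
  Up to the sign these are the Moebius functions from the proof of the Riemann mapping theorem,
  whose bound by \<open>1\<close> on the disk they share.
\<close>

lemma disk_involution_Moebius:
  "disk_involution a z = - Moebius_function 0 a z"
  by (simp add: disk_involution_def Moebius_function_simple minus_divide_left)

lemma disk_involution_denominator:
  assumes "a \<in> unit_disk" "z \<in> unit_disk"
  shows "1 - cnj a * z \<noteq> 0"
proof
  assume "1 - cnj a * z = 0"
  then have "norm a * norm z = 1"
    by (metis complex_mod_cnj eq_iff_diff_eq_0 norm_mult norm_one)
  moreover have "norm a * norm z < 1 * 1"
    using assms by (intro mult_strict_mono') auto
  ultimately show False by simp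
qed

lemma disk_involution_in_disk:
  assumes "a \<in> unit_disk" "z \<in> unit_disk"
  shows "disk_involution a z \<in> unit_disk"
  using assms Moebius_function_norm_lt_1[of a z 0] by (simp add: disk_involution_Moebius)

lemma disk_involution_holomorphic:
  assumes "a \<in> unit_disk"
  shows "disk_involution a holomorphic_on unit_disk"
  unfolding disk_involution_def
  using disk_involution_denominator[OF assms] by (intro holomorphic_intros) auto

lemma disk_involution_0 [simp]: "disk_involution a 0 = a"
  by (simp add: disk_involution_def)

lemma disk_involution_self [simp]: "disk_involution a a = 0"
  by (simp add: disk_involution_def)

lemma one_minus_cnj_mult_nonzero:
  assumes "a \<in> unit_disk"
  shows "1 - cnj a * a \<noteq> 0"
  using disk_involution_denominator[OF assms assms] .

lemma disk_involution_involution: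
  assumes "a \<in> unit_disk" "z \<in> unit_disk"
  shows "disk_involution a (disk_involution a z) = z"
proof -
  define d where "d = 1 - cnj a * z"
  have d: "d \<noteq> 0" and e: "1 - cnj a * a \<noteq> 0"
    using disk_involution_denominator[OF assms] one_minus_cnj_mult_nonzero[OF assms(1)]
    by (auto simp: d_def)
  have "a - disk_involution a z = z * (1 - cnj a * a) / d"
    using d by (simp add: disk_involution_def d_def field_simps)
  moreover have "1 - cnj a * disk_involution a z = (1 - cnj a * a) / d"
    using d by (simp add: disk_involution_def d_def field_simps)
  ultimately show ?thesis
    using d e by (simp add: disk_involution_def[of a "disk_involution a z"])
qed

lemma disk_involution_deriv:
  assumes "a \<in> unit_disk" "z \<in> unit_disk"
  shows "(disk_involution a has_field_derivative (cnj a * a - 1) / (1 - cnj a * z)\<^sup>2) (at z)"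
  unfolding disk_involution_def
  using disk_involution_denominator[OF assms]
  by (auto intro!: derivative_eq_intros simp: field_simps power2_eq_square)

section \<open>Linear fractional maps\<close>

lemma linear_fractional_disk_involution:
  assumes "a \<in> unit_disk"
  shows "linear_fractional (disk_involution a)"
  unfolding linear_fractional_def
proof (intro exI conjI ballI)
  show "(-1) * 1 - a * (- cnj a) \<noteq> 0"
    using one_minus_cnj_mult_nonzero[OF assms] by (simp add: algebra_simps)
  fix z :: complex assume "z \<in> unit_disk"
  then show "- cnj a * z + 1 \<noteq> 0"
    using disk_involution_denominator[OF assms] by (simp add: algebra_simps)
  show "disk_involution a z = ((-1) * z + a) / (- cnj a * z + 1)"
    by (simp add: disk_involution_def)
qed

lemma linear_fractional_compose:
  assumes "linear_fractional f" "linear_fractional g" "g ` unit_disk \<subseteq> unit_disk"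
  shows "linear_fractional (f \<circ> g)"
proof -
  obtain a b c d where det: "a * d - b * c \<noteq> 0"
    and f: "\<And>z. z \<in> unit_disk \<Longrightarrow> c * z + d \<noteq> 0 \<and> f z = (a * z + b) / (c * z + d)"
    using assms(1) unfolding linear_fractional_def by blast
  obtain a' b' c' d' where det': "a' * d' - b' * c' \<noteq> 0"
    and g: "\<And>z. z \<in> unit_disk \<Longrightarrow> c' * z + d' \<noteq> 0 \<and> g z = (a' * z + b') / (c' * z + d')"
    using assms(2) unfolding linear_fractional_def by blast
  show ?thesis
    unfolding linear_fractional_def
  proof (intro exI conjI ballI)
    have "(a * a' + b * c') * (c * b' + d * d') - (a * b' + b * d') * (c * a' + d * c')
        = (a * d - b * c) * (a' * d' - b' * c')"
      by (simp add: algebra_simps)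
    then show "(a * a' + b * c') * (c * b' + d * d') - (a * b' + b * d') * (c * a' + d * c') \<noteq> 0"
      using det det' by simp
    fix z :: complex assume z: "z \<in> unit_disk"
    define e where "e = c' * z + d'"
    have e: "e \<noteq> 0" and gz: "g z = (a' * z + b') / e"
      using g[OF z] by (auto simp: e_def)
    have gD: "g z \<in> unit_disk" using z assms(3) by blast
    have num: "(a * a' + b * c') * z + (a * b' + b * d') = (a * g z + b) * e"
      and den: "(c * a' + d * c') * z + (c * b' + d * d') = (c * g z + d) * e"
      using e unfolding gz by (simp_all add: field_simps) (simp_all add: e_def algebra_simps)
    show "(c * a' + d * c') * z + (c * b' + d * d') \<noteq> 0"
      unfolding den using f[OF gD] e by simp
    show "(f \<circ> g) z = ((a * a' + b * c') * z + (a * b' + b * d')) /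
        ((c * a' + d * c') * z + (c * b' + d * d'))"
      unfolding num den using f[OF gD] e by simp
  qed
qed

lemma linear_fractional_cong:
  assumes "\<And>z. z \<in> unit_disk \<Longrightarrow> f z = g z"
  shows "linear_fractional f \<longleftrightarrow> linear_fractional g"
  unfolding linear_fractional_def using assms by simp

lemma linear_fractional_deriv_nonzero:
  assumes "linear_fractional f" "z \<in> unit_disk"
  shows "deriv f z \<noteq> 0"
proof -
  obtain a b c d where det: "a * d - b * c \<noteq> 0"
    and f: "\<And>z. z \<in> unit_disk \<Longrightarrow> c * z + d \<noteq> 0 \<and> f z = (a * z + b) / (c * z + d)"
    using assms(1) unfolding linear_fractional_def by blast
  have nz: "c * z + d \<noteq> 0" using f[OF assms(2)] by blast
  have "((\<lambda>z. (a * z + b) / (c * z + d)) has_field_derivative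
      (a * d - b * c) / (c * z + d)\<^sup>2) (at z)"
    using nz by (auto intro!: derivative_eq_intros simp: field_simps power2_eq_square)
  then have "(f has_field_derivative (a * d - b * c) / (c * z + d)\<^sup>2) (at z)"
    by (rule has_field_derivative_transform_within_open[where S = unit_disk])
       (use f assms(2) in auto)
  then show ?thesis
    using det nz by (simp add: DERIV_imp_deriv)
qed

text \<open>
  The value at \<open>0\<close> kills the constant term of the numerator; then the functional equation at a single
  non-zero point gives \<open>c * lam = c\<close>, that is, \<open>c = 0\<close>.
\<close>

lemma linear_fractional_commuting_rotation:
  assumes "linear_fractional F" "F 0 = 0" "norm lam = 1" "lam \<noteq> 1"
    and comm: "\<And>z. z \<in> unit_disk \<Longrightarrow> F (lam * z) = lam * F z"
  obtains k where "\<And>z. z \<in> unit_disk \<Longrightarrow> F z = k * z"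
proof -
  obtain a b c d where det: "a * d - b * c \<noteq> 0"
    and f: "\<And>z. z \<in> unit_disk \<Longrightarrow> c * z + d \<noteq> 0 \<and> F z = (a * z + b) / (c * z + d)"
    using assms(1) unfolding linear_fractional_def by blast
  have "d \<noteq> 0" "b = 0" using f[of 0] assms(2) by auto
  then have "a \<noteq> 0" using det by auto
  have "lam \<noteq> 0" using assms(3) by auto
  \<comment> \<open>Any non-zero point of the disk would do.\<close>
  have D: "1/2 \<in> unit_disk" "lam * (1/2) \<in> unit_disk"
    using assms(3) by (auto simp: norm_mult norm_divide)
  have "a * (lam * (1/2)) / (c * (lam * (1/2)) + d) = lam * (a * (1/2) / (c * (1/2) + d))"
    using comm[OF D(1)] f[OF D(1)] f[OF D(2)] \<open>b = 0\<close> by (metis add.right_neutral)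
  then have "(a * lam / 2) / (c * (lam * (1/2)) + d) = (a * lam / 2) / (c * (1/2) + d)"
    by (simp add: mult.commute)
  moreover have "a * lam / 2 \<noteq> 0" using \<open>a \<noteq> 0\<close> \<open>lam \<noteq> 0\<close> by simp
  ultimately have "c * (lam * (1/2)) + d = c * (1/2) + d"
    using f[OF D(1)] f[OF D(2)] divide_cancel_left by blast
  then have "c = 0" using assms(4) by (simp add: algebra_simps)
  then show thesis
    using f \<open>b = 0\<close> by (intro that[of "a / d"]) auto
qed

section \<open>Schwarz lemma at an interior fixed point\<close>

lemma disk_self_mapD:
  assumes "disk_self_map f"
  shows "f holomorphic_on unit_disk" and "z \<in> unit_disk \<Longrightarrow> f z \<in> unit_disk"
  using assms unfolding disk_self_map_def by blast+

lemma disk_self_map_compose: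
  assumes "disk_self_map f" "disk_self_map g"
  shows "disk_self_map (f \<circ> g)"
  using assms holomorphic_on_compose_gen[of g unit_disk f unit_disk]
  unfolding disk_self_map_def by fastforce

lemma disk_self_map_disk_involution:
  assumes "a \<in> unit_disk"
  shows "disk_self_map (disk_involution a)"
  using disk_involution_holomorphic disk_involution_in_disk assms
  unfolding disk_self_map_def by blast

lemma disk_self_map_conjugate:
  assumes "disk_self_map f" "a \<in> unit_disk"
  shows "disk_self_map (disk_involution (f a) \<circ> f \<circ> disk_involution a)"
  using assms disk_self_mapD(2)
  by (intro disk_self_map_compose disk_self_map_disk_involution) auto

text \<open>
  The derivatives of the involution at \<open>0\<close> and at \<open>a\<close> are reciprocal, so the multiplier at the
  fixed point is invariant under the conjugation.
\<close>

lemma deriv_conjugate_fixed_point: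
  assumes "disk_self_map f" "a \<in> unit_disk" "f a = a"
  shows "deriv (disk_involution a \<circ> f \<circ> disk_involution a) 0 = deriv f a"
proof -
  have f: "(f has_field_derivative deriv f a) (at (disk_involution a 0))"
    using assms holomorphic_derivI[of f unit_disk a] by (simp add: disk_self_map_def)
  have i0: "(disk_involution a has_field_derivative cnj a * a - 1) (at 0)"
    using disk_involution_deriv[OF assms(2), of 0] by simp
  have ia: "(disk_involution a has_field_derivative (cnj a * a - 1) / (1 - cnj a * a)\<^sup>2)
      (at ((f \<circ> disk_involution a) 0))"
    using disk_involution_deriv[OF assms(2,2)] assms(3) by simp
  have "(disk_involution a \<circ> (f \<circ> disk_involution a) has_field_derivative
      (cnj a * a - 1) / (1 - cnj a * a)\<^sup>2 * (deriv f a * (cnj a * a - 1))) (at 0)"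
    by (rule DERIV_chain[OF ia DERIV_chain[OF f i0]])
  moreover have "(cnj a * a - 1) / (1 - cnj a * a)\<^sup>2 * (deriv f a * (cnj a * a - 1)) = deriv f a"
  proof -
    define e where "e = 1 - cnj a * a"
    have e: "e \<noteq> 0" and m: "cnj a * a - 1 = - e"
      using one_minus_cnj_mult_nonzero[OF assms(2)] by (auto simp: e_def)
    show ?thesis unfolding m using e by (simp add: e_def[symmetric] power2_eq_square)
  qed
  ultimately show ?thesis by (simp add: DERIV_imp_deriv comp_assoc)
qed

text \<open>
  The equality case of the Schwarz lemma, transported from the origin to \<open>a\<close>.
\<close>

lemma rotation_at_fixed_point:
  assumes f: "disk_self_map f" and a: "a \<in> unit_disk" and fixed: "f a = a"
    and extremal: "norm (deriv f a) = 1 \<or>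
      (\<exists>z\<in>unit_disk. z \<noteq> 0 \<and> norm ((disk_involution a \<circ> f \<circ> disk_involution a) z) = norm z)"
  shows "norm (deriv f a) = 1"
    and "\<And>z. z \<in> unit_disk \<Longrightarrow> f (disk_involution a z) = disk_involution a (deriv f a * z)"
proof -
  let ?F = "disk_involution a \<circ> f \<circ> disk_involution a"
  have F: "disk_self_map ?F" using disk_self_map_conjugate[OF f a] fixed by simp
  have F0: "?F 0 = 0" using fixed by simp
  have dF: "deriv ?F 0 = deriv f a" by (rule deriv_conjugate_fixed_point[OF f a fixed])
  have hol: "?F holomorphic_on unit_disk" and lt: "\<And>z. norm z < 1 \<Longrightarrow> norm (?F z) < 1"
    using F unfolding disk_self_map_def by (auto simp: image_subset_iff)
  have "\<exists>\<alpha>. (\<forall>z. norm z < 1 \<longrightarrow> ?F z = \<alpha> * z) \<and> norm \<alpha> = 1"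
  proof (rule Schwarz_Lemma(3)[OF hol F0 lt, of 0])
    show "(\<exists>z. norm z < 1 \<and> z \<noteq> 0 \<and> norm (?F z) = norm z) \<or> norm (deriv ?F 0) = 1"
      using extremal unfolding dF by auto
  qed auto
  then obtain \<alpha> where \<alpha>: "\<And>z. z \<in> unit_disk \<Longrightarrow> ?F z = \<alpha> * z" "norm \<alpha> = 1" by auto
  have "(?F has_field_derivative \<alpha>) (at 0)"
    by (rule has_field_derivative_transform_within_open[where f = "\<lambda>z. \<alpha> * z" and S = unit_disk])
       (use \<alpha> in \<open>auto intro!: derivative_eq_intros\<close>)
  then have "deriv f a = \<alpha>" using dF DERIV_imp_deriv by metis
  then show "norm (deriv f a) = 1" using \<alpha> by simp
  fix z :: complex assume z: "z \<in> unit_disk"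
  have "f (disk_involution a z) \<in> unit_disk"
    using disk_self_mapD(2)[OF f disk_involution_in_disk[OF a z]] .
  then have "f (disk_involution a z) = disk_involution a (?F z)"
    by (simp add: disk_involution_involution[OF a])
  then show "f (disk_involution a z) = disk_involution a (deriv f a * z)"
    using \<alpha>(1)[OF z] \<open>deriv f a = \<alpha>\<close> by metis
qed

text \<open>
  After conjugation, a second fixed point is a point other than \<open>0\<close> where equality holds in the
  Schwarz lemma; the resulting rotation fixes a non-zero point and is trivial.
\<close>

lemma unique_fixed_point:
  assumes f: "disk_self_map f" and ni: "\<not> disk_identity f"
    and a: "a \<in> unit_disk" "f a = a" and b: "b \<in> unit_disk" "f b = b"
  shows "a = b"
proof (rule ccontr)
  assume ne: "a \<noteq> b"
  define w where "w = disk_involution a b"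
  have w: "w \<in> unit_disk" "disk_involution a w = b"
    using disk_involution_in_disk[OF a(1) b(1)] disk_involution_involution[OF a(1) b(1)]
    by (auto simp: w_def)
  then have "w \<noteq> 0" using ne by auto
  have fw: "(disk_involution a \<circ> f \<circ> disk_involution a) w = w"
    using w b by (simp add: w_def)
  then have rot: "norm (deriv f a) = 1"
    "\<And>z. z \<in> unit_disk \<Longrightarrow> f (disk_involution a z) = disk_involution a (deriv f a * z)"
    using rotation_at_fixed_point[OF f a] w(1) \<open>w \<noteq> 0\<close> by metis+
  have "deriv f a * w \<in> unit_disk" using rot(1) w(1) by (simp add: norm_mult)
  then have "deriv f a * w = w"
    using rot(2)[OF w(1)] fw by (simp add: disk_involution_involution[OF a(1)])
  then have one: "deriv f a = 1" using \<open>w \<noteq> 0\<close> by simp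
  have "f z = z" if "z \<in> unit_disk" for z
    using rot(2)[OF disk_involution_in_disk[OF a(1) that]] one that
    by (simp add: disk_involution_involution[OF a(1)])
  then show False using ni by (simp add: disk_identity_def)
qed

text \<open>
  The inverse of an automorphism is again a self-map, so the Schwarz lemma bounds the derivatives of
  both at the fixed point by \<open>1\<close>. Their product is \<open>1\<close>, hence both have modulus \<open>1\<close> and the equality
  case applies.
\<close>

lemma automorphism_is_rotation:
  assumes f: "disk_automorphism f" and a: "a \<in> unit_disk" and fixed: "f a = a"
  shows "norm (deriv f a) = 1"
    and "\<And>z. z \<in> unit_disk \<Longrightarrow> f (disk_involution a z) = disk_involution a (deriv f a * z)"
proof -
  have sm: "disk_self_map f" and hol: "f holomorphic_on unit_disk"
    and bij: "bij_betw f unit_disk unit_disk"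
    using f by (auto simp: disk_automorphism_def disk_self_map_def)
  obtain g where g: "g holomorphic_on (f ` unit_disk)"
    "\<And>z. z \<in> unit_disk \<Longrightarrow> deriv f z * deriv g (f z) = 1"
    "\<And>z. z \<in> unit_disk \<Longrightarrow> g (f z) = z"
    using holomorphic_has_inverse[OF hol open_ball] bij by (metis bij_betw_def)
  have img: "f ` unit_disk = unit_disk" using bij by (simp add: bij_betw_def)
  have "g ` unit_disk \<subseteq> unit_disk"
    by (subst img[symmetric]) (auto simp: g(3))
  then have gsm: "disk_self_map g" using g(1) img by (simp add: disk_self_map_def)
  have ga: "g a = a" using g(3)[OF a] fixed by simp
  have le: "norm (deriv k a) \<le> 1" if k: "disk_self_map k" "k a = a" for k
  proof -
    let ?F = "disk_involution a \<circ> k \<circ> disk_involution a"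
    have "disk_self_map ?F" using disk_self_map_conjugate[OF k(1) a] k(2) by simp
    then have "?F holomorphic_on unit_disk" "\<And>z. norm z < 1 \<Longrightarrow> norm (?F z) < 1"
      unfolding disk_self_map_def by (auto simp: image_subset_iff)
    then have "norm (deriv ?F 0) \<le> 1"
      using k(2) by (intro Schwarz_Lemma(2)[where \<xi> = 0]) auto
    then show ?thesis using deriv_conjugate_fixed_point[OF k(1) a k(2)] by simp
  qed
  have "norm (deriv f a) * norm (deriv g a) = 1"
    using g(2)[OF a] fixed by (metis norm_mult norm_one)
  moreover have "norm (deriv f a) * norm (deriv g a) \<le> norm (deriv f a) * 1"
    using le[OF gsm ga] by (intro mult_left_mono) auto
  ultimately have one: "norm (deriv f a) = 1" using le[OF sm fixed] by linarith
  then show "norm (deriv f a) = 1" .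
  show "\<And>z. z \<in> unit_disk \<Longrightarrow> f (disk_involution a z) = disk_involution a (deriv f a * z)"
    using rotation_at_fixed_point(2)[OF sm a fixed] one by blast
qed

section \<open>Order of vanishing at a point\<close>

text \<open>
  Identities obtained by cancelling a power of \<open>z\<close> hold only off the origin; this extends them.
\<close>

lemma holomorphic_eq_at_centre:
  assumes "f holomorphic_on unit_disk" "g holomorphic_on unit_disk"
    and "\<And>z. z \<in> unit_disk \<Longrightarrow> z \<noteq> 0 \<Longrightarrow> f z = g z"
  shows "f 0 = g 0"
proof (rule analytic_continuation_open[where f = f and g = g and z = 0 and s = "unit_disk - {0}" and s' = unit_disk])
  have "(1/2 :: complex) \<in> unit_disk - {0}" by simp
  then show "unit_disk - {0} \<noteq> ({} :: complex set)" by blast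
  show "f z = g z" if "z \<in> unit_disk - {0}" for z
    using assms(3) that by blast
qed (use assms(1,2) in \<open>auto intro: open_delete\<close>)

text \<open>
  Near \<open>p\<close> the factor comes from the Taylor expansion; elsewhere it is a quotient of holomorphic
  functions. The two agree on the punctured neighbourhood and glue together.
\<close>

lemma holomorphic_factor_order_global:
  fixes n :: nat
  assumes hol: "f holomorphic_on S" and S: "open S" "p \<in> S" and n: "0 < n"
    and nz: "(deriv ^^ n) f p \<noteq> 0"
    and z: "\<And>i. \<lbrakk>0 < i; i < n\<rbrakk> \<Longrightarrow> (deriv ^^ i) f p = 0"
  obtains h where "h holomorphic_on S" "h p \<noteq> 0"
    "\<And>w. w \<in> S \<Longrightarrow> f w = f p + (w - p) ^ n * h w"
proof -
  obtain g r where r: "0 < r" and g: "g holomorphic_on ball p r"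
    and eq: "\<And>w. w \<in> ball p r \<Longrightarrow> f w - f p = (w - p) ^ n * g w"
    and g0: "\<And>w. w \<in> ball p r \<Longrightarrow> g w \<noteq> 0"
    by (rule holomorphic_factor_order_of_zero[OF hol S n nz z]) auto
  define h where "h w = (if w \<in> ball p r then g w else (f w - f p) / (w - p) ^ n)" for w
  have "h holomorphic_on (ball p r \<union> (S - {p}))"
    unfolding h_def
    by (rule holomorphic_on_If_Un)
       (use g S eq in \<open>auto intro!: holomorphic_intros holomorphic_on_subset[OF hol]\<close>)
  then have "h holomorphic_on S" by (rule holomorphic_on_subset) (use r in auto)
  moreover have "h p \<noteq> 0" using g0 r by (simp add: h_def)
  moreover have "f w = f p + (w - p) ^ n * h w" if "w \<in> S" for w
  proof (cases "w \<in> ball p r")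
    case True
    then show ?thesis using eq[OF True] by (simp add: h_def algebra_simps)
  next
    case False
    then have "w \<noteq> p" using r by auto
    then show ?thesis using False by (simp add: h_def)
  qed
  ultimately show thesis using that by blast
qed

text \<open>
  Each of the two identities
  \<open>\<phi>\<^sub>p z - p = z * (\<bar>p\<bar>\<^sup>2 - 1) / (1 - cnj p * z)\<close> and \<open>\<phi>\<^sub>q u = - (u - q) / (1 - cnj q * u)\<close>
  shows that the involution changes the order of vanishing only by a non-vanishing factor. So, with
  \<open>q = f p\<close>, the factorization \<open>f w = q + (w - p) ^ n * h w\<close> yields an explicit formula for \<open>H\<close>.
\<close>

lemma conjugate_order_factorization:
  assumes f: "disk_self_map f" and nc: "\<not> f constant_on unit_disk" and p: "p \<in> unit_disk"
    and n: "n = (LEAST n. n \<ge> 1 \<and> (deriv ^^ n) f p \<noteq> 0)"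
  obtains H where "1 \<le> n" "H holomorphic_on unit_disk" "H 0 \<noteq> 0"
    "\<And>z. z \<in> unit_disk \<Longrightarrow>
       (disk_involution (f p) \<circ> f \<circ> disk_involution p) z = z ^ n * H z"
proof -
  note hol = disk_self_mapD(1)[OF f] and img = disk_self_mapD(2)[OF f]
  note fp = img[OF p]
  have "\<exists>n. n \<ge> 1 \<and> (deriv ^^ n) f p \<noteq> 0"
  proof (rule ccontr)
    assume none: "\<not> ?thesis"
    have "(deriv ^^ k) f p = 0" if "0 < k" for k
    proof -
      have "1 \<le> k" using that by simp
      then show ?thesis using none by blast
    qed
    then have "f w = f p" if "w \<in> unit_disk" for w
      by (rule holomorphic_fun_eq_const_on_connected[OF hol open_ball connected_ball _ p that])
    then show False using nc by (auto simp: constant_on_def)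
  qed
  from LeastI_ex[OF this] have n1: "1 \<le> n" and nz: "(deriv ^^ n) f p \<noteq> 0"
    by (auto simp: n)
  have low: "(deriv ^^ i) f p = 0" if "0 < i" "i < n" for i
    using not_less_Least[of i "\<lambda>n. n \<ge> 1 \<and> (deriv ^^ n) f p \<noteq> 0"] that n by auto
  obtain h where h: "h holomorphic_on unit_disk" "h p \<noteq> 0"
    and fh: "\<And>w. w \<in> unit_disk \<Longrightarrow> f w = f p + (w - p) ^ n * h w"
    by (rule holomorphic_factor_order_global[OF hol open_ball p _ nz low])
       (use n1 in auto)
  let ?q = "f p" and ?i = "disk_involution p"
  define H where "H z = - (((cnj p * p - 1) / (1 - cnj p * z)) ^ n * h (?i z)) /
    (1 - cnj ?q * f (?i z))" for z
  have comp: "(\<lambda>z. k (?i z)) holomorphic_on unit_disk" if "k holomorphic_on unit_disk" for k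
  proof -
    have "?i ` unit_disk \<subseteq> unit_disk" using disk_involution_in_disk[OF p] by blast
    then show ?thesis
      using holomorphic_on_compose_gen[OF disk_involution_holomorphic[OF p] that]
      by (simp add: o_def)
  qed
  have nzp: "1 - cnj p * z \<noteq> 0" and nzq: "1 - cnj ?q * f (?i z) \<noteq> 0"
    if "z \<in> unit_disk" for z
    using that disk_involution_denominator[OF p] disk_involution_denominator[OF fp img]
      disk_involution_in_disk[OF p] by auto
  have "H holomorphic_on unit_disk"
    unfolding H_def by (intro holomorphic_intros comp h hol) (use nzp nzq in auto)
  moreover have "H 0 \<noteq> 0"
    using h(2) nzq[of 0] one_minus_cnj_mult_nonzero[OF p] by (simp add: H_def)
  moreover have "(disk_involution ?q \<circ> f \<circ> ?i) z = z ^ n * H z" if z: "z \<in> unit_disk" for z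
  proof -
    have "?i z - p = z * ((cnj p * p - 1) / (1 - cnj p * z))"
      using nzp[OF z] by (simp add: disk_involution_def field_simps)
    then have "f (?i z) = ?q + z ^ n * ((cnj p * p - 1) / (1 - cnj p * z)) ^ n * h (?i z)"
      using fh[OF disk_involution_in_disk[OF p z]] by (simp only: power_mult_distrib)
    then have "?q - f (?i z) = z ^ n * (- (((cnj p * p - 1) / (1 - cnj p * z)) ^ n * h (?i z)))"
      by simp
    then show ?thesis
      by (simp add: disk_involution_def[of ?q] H_def)
  qed
  ultimately show thesis using that n1 by blast
qed

text \<open>
  On the circle of radius \<open>r < 1\<close> the hypothesis gives \<open>\<bar>H\<bar> \<le> 1 / r ^ n\<close>, the maximum principle
  carries this inside, and \<open>r\<close> tends to \<open>1\<close>.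
\<close>

lemma power_quotient_bound:
  assumes H: "H holomorphic_on unit_disk"
    and le: "\<And>z. z \<in> unit_disk \<Longrightarrow> norm (z ^ n * H z) \<le> 1"
    and z: "z \<in> unit_disk"
  shows "norm (H z) \<le> 1"
proof -
  have bound: "norm (H z) * r ^ n \<le> 1" if r: "norm z < r" "r < 1" for r
  proof -
    have "0 < r" using r by (meson norm_ge_zero le_less_trans)
    have "norm (H z) \<le> 1 / r ^ n"
    proof (rule maximum_modulus_frontier[where f = H and \<xi> = z and S = "ball 0 r"])
      have sub: "cball 0 r \<subseteq> unit_disk" using r by auto
      show "H holomorphic_on interior (ball 0 r)"
        by (rule holomorphic_on_subset[OF H]) (use r in auto)
      show "continuous_on (closure (ball 0 r)) H"
        using holomorphic_on_imp_continuous_on[OF H] sub \<open>0 < r\<close>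
        by (auto intro: continuous_on_subset)
      show "z \<in> ball 0 r" using r by simp
      fix w :: complex assume "w \<in> frontier (ball 0 r)"
      then have w: "norm w = r" using \<open>0 < r\<close> by (simp add: frontier_ball)
      then show "norm (H w) \<le> 1 / r ^ n"
        using le[of w] r \<open>0 < r\<close> by (simp add: norm_mult norm_power field_simps)
    qed simp
    then show ?thesis using \<open>0 < r\<close> by (simp add: field_simps)
  qed
  have "((\<lambda>r. norm (H z) * r ^ n) \<longlongrightarrow> norm (H z) * 1 ^ n) (at_left (1::real))"
    by (intro tendsto_intros)
  moreover have "eventually (\<lambda>r. norm (H z) * r ^ n \<le> 1) (at_left (1::real))"
    using eventually_at_left[of "norm z" "1::real"] bound z by auto
  ultimately show ?thesis
    using tendsto_upperbound[OF _ _ trivial_limit_at_left_real] by fastforce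
qed

text \<open>
  If a value of modulus \<open>1\<close> is attained inside, then the maximum principle makes \<open>g\<close> constant.
\<close>

lemma bounded_by_one_dichotomy:
  assumes g: "g holomorphic_on unit_disk" and le: "\<And>z. z \<in> unit_disk \<Longrightarrow> norm (g z) \<le> 1"
  shows "disk_self_map g \<or> (\<exists>c. norm c = 1 \<and> (\<forall>z\<in>unit_disk. g z = c))"
proof (cases "disk_self_map g")
  case False
  then obtain w where w: "w \<in> unit_disk" "\<not> norm (g w) < 1"
    using g unfolding disk_self_map_def by fastforce
  then have one: "norm (g w) = 1" using le[OF w(1)] by simp
  have "g constant_on unit_disk"
    by (rule maximum_modulus_principle[where U = unit_disk and \<xi> = w])
       (use g w le one in auto)
  then have "\<forall>z\<in>unit_disk. g z = g w" using w(1) by (auto simp: constant_on_def)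
  then show ?thesis using one by blast
qed simp

section \<open>Functions invariant under a rotation\<close>

text \<open>
  The \<open>n\<close>-th derivative at \<open>0\<close> of \<open>z \<mapsto> H (lam * z)\<close> is \<open>lam ^ n\<close> times that of \<open>H\<close>.
\<close>

lemma rotation_invariant_coefficients:
  assumes H: "H holomorphic_on unit_disk" and lam: "norm lam = 1"
    and inv: "\<And>z. z \<in> unit_disk \<Longrightarrow> H (lam * z) = H z"
    and n: "lam ^ n \<noteq> 1"
  shows "(deriv ^^ n) H 0 = 0"
proof -
  have rot: "lam * z \<in> unit_disk" if "z \<in> unit_disk" for z
    using that lam by (simp add: norm_mult)
  have hol: "(\<lambda>z. H (lam * z)) holomorphic_on unit_disk"
    using H by (rule holomorphic_transform) (use inv in auto)
  have "lam ^ n * (deriv ^^ n) H 0 = (deriv ^^ n) (\<lambda>z. H (lam * z)) 0"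
    using higher_deriv_compose_linear[OF H open_ball open_ball, of 0 0 1 lam n] rot by simp
  also have "\<dots> = (deriv ^^ n) H 0"
    by (rule higher_deriv_transform_within_open[OF hol H open_ball]) (use inv in auto)
  finally show ?thesis using n by simp
qed

lemma irrational_rotation_invariant_constant:
  assumes H: "H holomorphic_on unit_disk" and lam: "norm lam = 1"
    and inv: "\<And>z. z \<in> unit_disk \<Longrightarrow> H (lam * z) = H z"
    and n: "\<forall>n\<ge>1. lam ^ n \<noteq> 1" and z: "z \<in> unit_disk"
  shows "H z = H 0"
  by (rule holomorphic_fun_eq_const_on_connected[OF H open_ball connected_ball _ _ z])
     (use rotation_invariant_coefficients[OF H lam inv] n in auto)

lemma power_eq_one_iff_dvd_least:
  fixes lam :: complex
  assumes ex: "\<exists>n\<ge>1. lam ^ n = 1" and m: "m = (LEAST n. n \<ge> 1 \<and> lam ^ n = 1)"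
  shows "m \<ge> 1" and "lam ^ m = 1" and "lam ^ n = 1 \<Longrightarrow> m dvd n"
proof -
  have "m \<ge> 1 \<and> lam ^ m = 1" unfolding m by (rule LeastI_ex) (use ex in auto)
  then show m1: "m \<ge> 1" and lm: "lam ^ m = 1" by auto
  assume "lam ^ n = 1"
  moreover have "lam ^ n = lam ^ (n mod m)"
    by (metis lm mod_mult_div_eq mult.commute mult_1 power_add power_mult power_one)
  ultimately have "\<not> n mod m \<ge> 1"
    using not_less_Least[of "n mod m" "\<lambda>n. n \<ge> 1 \<and> lam ^ n = 1"] m1 m
    by (auto simp: Suc_le_eq)
  then show "m dvd n" by (simp add: mod_eq_0_iff_dvd Suc_le_eq)
qed

lemma nth_root_in_disk:
  assumes "w \<in> unit_disk" "m \<ge> 1"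
  obtains z where "z \<in> unit_disk" "z ^ m = w"
proof -
  obtain z where z: "z ^ m = w" using exists_complex_root[of m w] assms(2) by auto
  then have "norm z ^ m < 1" using assms(1) by (auto simp: norm_power)
  then have "norm z < 1" using one_le_power[of "norm z" m] by (meson not_le)
  then show thesis using that z by simp
qed

lemma power_in_disk:
  fixes z :: complex
  assumes "z \<in> unit_disk" "m \<ge> 1"
  shows "z ^ m \<in> unit_disk"
proof -
  have "norm z ^ m \<le> norm z ^ 1"
    using assms by (intro power_decreasing) auto
  then show ?thesis using assms(1) by (simp add: norm_power)
qed

text \<open>
  The Taylor series of \<open>H\<close> is supported on the multiples of \<open>m\<close>, hence is a power series in
  \<open>z ^ m\<close>. That series converges throughout the disk, because every point of the disk is the
  \<open>m\<close>-th power of a point of the disk. Equality of the images transfers bounds from \<open>H\<close> to \<open>g\<close>.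
\<close>

lemma rotation_invariant_factors_through_power:
  assumes H: "H holomorphic_on unit_disk" and lam: "norm lam = 1"
    and inv: "\<And>z. z \<in> unit_disk \<Longrightarrow> H (lam * z) = H z"
    and m: "m \<ge> 1" and dvd: "\<And>n. lam ^ n = 1 \<Longrightarrow> m dvd n"
  shows "\<exists>g. g holomorphic_on unit_disk \<and> (\<forall>z\<in>unit_disk. H z = g (z ^ m)) \<and>
    g ` unit_disk = H ` unit_disk"
proof -
  define a where "a n = (deriv ^^ n) H 0 / fact n" for n
  define g where "g w = (\<Sum>k. a (m * k) * w ^ k)" for w
  have mono: "strict_mono (\<lambda>k. m * k)" using m by (simp add: strict_mono_def)
  have S: "(\<lambda>k. a (m * k) * (z ^ m) ^ k) sums H z" if "z \<in> unit_disk" for z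
  proof -
    have "(\<lambda>n. a n * z ^ n) sums H z"
      using holomorphic_power_series[OF H that] by (simp add: a_def)
    moreover have "a n * z ^ n = 0" if "n \<notin> range (\<lambda>k. m * k)" for n
      using rotation_invariant_coefficients[OF H lam inv] dvd[of n] that
      by (auto simp: a_def dvd_def)
    ultimately have "(\<lambda>k. a (m * k) * z ^ (m * k)) sums H z"
      using sums_mono_reindex[OF mono, of "\<lambda>n. a n * z ^ n"] by blast
    then show ?thesis by (simp add: power_mult)
  qed
  have eq: "H z = g (z ^ m)" if "z \<in> unit_disk" for z
    using sums_unique[OF S[OF that]] by (simp add: g_def)
  have "g holomorphic_on unit_disk"
  proof (rule power_series_holomorphic)
    fix w :: complex assume "w \<in> unit_disk"
    then obtain z where z: "z \<in> unit_disk" "z ^ m = w" using nth_root_in_disk m by metis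
    show "(\<lambda>k. a (m * k) * (w - 0) ^ k) sums g w"
      using S[OF z(1)] eq[OF z(1)] z(2) by simp
  qed
  moreover have "g ` unit_disk = H ` unit_disk"
  proof
    show "g ` unit_disk \<subseteq> H ` unit_disk"
    proof
      fix y assume "y \<in> g ` unit_disk"
      then obtain w where w: "w \<in> unit_disk" "y = g w" by auto
      obtain z where "z \<in> unit_disk" "z ^ m = w" using nth_root_in_disk[OF w(1) m] by metis
      then show "y \<in> H ` unit_disk" using eq w by auto
    qed
    show "H ` unit_disk \<subseteq> g ` unit_disk"
    proof
      fix y assume "y \<in> H ` unit_disk"
      then obtain z where z: "z \<in> unit_disk" "y = H z" by auto
      have "z ^ m \<in> unit_disk" using power_in_disk[OF z(1) m] .
      then show "y \<in> g ` unit_disk" using eq[OF z(1)] z(2) by auto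
    qed
  qed
  ultimately show ?thesis using eq by blast
qed

section \<open>Semiconjugate rotations\<close>

text \<open>
  Conjugating twice by the involutions gives back \<open>f\<close>, so it is enough that composition preserves
  linear fractional self-maps.
\<close>

lemma linear_fractional_conjugate_iff:
  assumes f: "disk_self_map f" and p: "p \<in> unit_disk"
  shows "linear_fractional (disk_involution (f p) \<circ> f \<circ> disk_involution p)
    \<longleftrightarrow> linear_fractional f" (is "linear_fractional ?F \<longleftrightarrow> _")
proof -
  have fp: "f p \<in> unit_disk" using disk_self_mapD(2)[OF f p] .
  have conj: "linear_fractional (disk_involution b \<circ> (k \<circ> disk_involution a))"
    if "linear_fractional k" "disk_self_map k" "a \<in> unit_disk" "b \<in> unit_disk" for k a b
    using that disk_self_map_compose[OF that(2) disk_self_map_disk_involution[OF that(3)]]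
      disk_self_map_disk_involution[OF that(3)]
    by (intro linear_fractional_compose linear_fractional_disk_involution)
       (auto simp: disk_self_map_def)
  have "linear_fractional f" if F: "linear_fractional ?F"
  proof -
    have "linear_fractional (disk_involution (f p) \<circ> (?F \<circ> disk_involution p))"
      using conj[OF F disk_self_map_conjugate[OF f p] p fp] .
    moreover have "(disk_involution (f p) \<circ> (?F \<circ> disk_involution p)) z = f z"
      if "z \<in> unit_disk" for z
      using disk_involution_involution[OF p that]
        disk_involution_involution[OF fp disk_self_mapD(2)[OF f that]] by simp
    ultimately show ?thesis using linear_fractional_cong by blast
  qed
  then show ?thesis using conj[OF _ f p fp] by (auto simp: comp_assoc)
qed

text \<open>
  Write \<open>\<Psi> w = w * K w\<close> with \<open>K 0 = \<Psi>' 0\<close>. Then the functional equation is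
  \<open>lam ^ n * z ^ n * H (lam * z) = z ^ n * H z * K (F z)\<close>; cancel \<open>z ^ n\<close> and evaluate at \<open>0\<close>.
\<close>

lemma semiconjugacy_multiplier:
  assumes F: "disk_self_map F" and H: "H holomorphic_on unit_disk" "H 0 \<noteq> 0"
    and FH: "\<And>z. z \<in> unit_disk \<Longrightarrow> F z = z ^ n * H z" and n: "n \<ge> 1"
    and Psi: "\<Psi> holomorphic_on unit_disk" "\<Psi> 0 = 0"
    and lam: "norm lam = 1"
    and semi: "\<And>z. z \<in> unit_disk \<Longrightarrow> F (lam * z) = \<Psi> (F z)"
  shows "lam ^ n = deriv \<Psi> 0"
proof -
  obtain K where K: "K holomorphic_on unit_disk" "\<And>z. norm z < 1 \<Longrightarrow> \<Psi> z = z * K z"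
    "deriv \<Psi> 0 = K 0"
    using Schwarz3[OF Psi] by blast
  have rot: "lam * z \<in> unit_disk" if "z \<in> unit_disk" for z
    using that lam by (simp add: norm_mult)
  have "H \<circ> (\<lambda>z. lam * z) holomorphic_on unit_disk"
    by (rule holomorphic_on_compose_gen[OF _ H(1)]) (use rot in \<open>auto intro!: holomorphic_intros\<close>)
  then have h1: "(\<lambda>z. lam ^ n * H (lam * z)) holomorphic_on unit_disk"
    by (intro holomorphic_intros) (simp add: o_def)
  have "K \<circ> F holomorphic_on unit_disk"
    by (rule holomorphic_on_compose_gen[OF _ K(1)]) (use F in \<open>auto simp only: disk_self_map_def\<close>)
  then have h2: "(\<lambda>z. H z * K (F z)) holomorphic_on unit_disk"
    by (intro holomorphic_intros H) (simp add: o_def)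
  have "lam ^ n * H (lam * 0) = H 0 * K (F 0)"
  proof (rule holomorphic_eq_at_centre[OF h1 h2])
    fix z :: complex assume z: "z \<in> unit_disk" "z \<noteq> 0"
    have "norm (F z) < 1" using disk_self_mapD(2)[OF F z(1)] by simp
    then have "(lam * z) ^ n * H (lam * z) = (z ^ n * H z) * K (F z)"
      using semi[OF z(1)] FH[OF z(1)] FH[OF rot[OF z(1)]] K(2) by metis
    then have "z ^ n * (lam ^ n * H (lam * z)) = z ^ n * (H z * K (F z))"
      by (simp add: power_mult_distrib mult_ac)
    then show "lam ^ n * H (lam * z) = H z * K (F z)" using z(2) by simp
  qed
  moreover have "F 0 = 0" using FH[of 0] n by simp
  ultimately show ?thesis using K(3) H(2) by simp
qed

theorem theorem5:
  fixes \<phi> \<psi> f :: "complex \<Rightarrow> complex" and p lam :: complex and n0 m0 :: nat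
  assumes "disk_automorphism \<phi>" and "elliptic \<phi>"
    and "denjoy_wolff_point \<phi> p"
    and "lam = deriv \<phi> p"
    and "disk_self_map \<psi>" and "linear_fractional \<psi>"
    and "disk_self_map f" and "\<not> f constant_on unit_disk"
    and "\<forall>z\<in>unit_disk. (f \<circ> \<phi>) z = (\<psi> \<circ> f) z"
    and "n0 = (LEAST n. n \<ge> 1 \<and> (deriv ^^ n) f p \<noteq> 0)"
    and "m0 = (LEAST n. n \<ge> 1 \<and> lam ^ n = 1)"
  shows
    "(disk_identity \<psi> \<longrightarrow>
        (\<exists>n\<ge>1. lam ^ n = 1) \<and>
        (\<exists>g. disk_self_map g \<and> \<not> g constant_on unit_disk \<and> g 0 = 0 \<and>
           (\<forall>z\<in>unit_disk.
              (disk_involution (f p) \<circ> f \<circ> disk_involution p) z = g (z ^ m0))) \<and>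
        \<not> linear_fractional f)
     \<and>
     (\<forall>q \<mu>. \<not> disk_identity \<psi> \<and> denjoy_wolff_point \<psi> q \<and> \<mu> = deriv \<psi> q \<longrightarrow>
        lam ^ n0 = \<mu> \<and>
        ((\<forall>n\<ge>1. lam ^ n \<noteq> 1) \<longrightarrow>
           (\<exists>\<beta>\<in>cball 0 1 - {0}. \<forall>z\<in>unit_disk.
              (disk_involution q \<circ> f \<circ> disk_involution p) z = \<beta> * z ^ n0) \<and>
           (linear_fractional f \<longleftrightarrow> n0 = 1)) \<and>
        ((\<exists>n\<ge>1. lam ^ n = 1) \<longrightarrow>
           (\<exists>g. (disk_self_map g \<or> (\<exists>c. norm c = 1 \<and> (\<forall>z\<in>unit_disk. g z = c))) \<and>
              (\<exists>z\<in>unit_disk. g z \<noteq> 0) \<and>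
              (\<forall>z\<in>unit_disk.
                 (disk_involution q \<circ> f \<circ> disk_involution p) z = z ^ n0 * g (z ^ m0)) \<and>
              (linear_fractional f \<longleftrightarrow> g constant_on unit_disk \<and> n0 = 1))))"
proof -
  have p: "p \<in> unit_disk" and \<phi>p: "\<phi> p = p"
    using assms(2,3) by (auto simp: denjoy_wolff_point_def)
  have \<phi>: "disk_self_map \<phi>" using assms(1) by (simp add: disk_automorphism_def)
  have lam: "norm lam = 1"
    and \<phi>rot: "\<And>z. z \<in> unit_disk \<Longrightarrow> \<phi> (disk_involution p z) = disk_involution p (lam * z)"
    using automorphism_is_rotation[OF assms(1) p \<phi>p] assms(4) by auto
  have rot: "lam * z \<in> unit_disk" if "z \<in> unit_disk" for z
    using that lam by (simp add: norm_mult)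
  have lam1: "lam \<noteq> 1"
  proof
    assume "lam = 1"
    then have "\<phi> z = z" if "z \<in> unit_disk" for z
      using \<phi>rot[OF disk_involution_in_disk[OF p that]] disk_involution_involution[OF p that] by simp
    then show False using assms(2) by (simp add: elliptic_def disk_identity_def)
  qed
  note f = assms(7)
  have semi: "f (\<phi> z) = \<psi> (f z)" if "z \<in> unit_disk" for z using assms(9) that by simp
  have fp: "f p \<in> unit_disk" using disk_self_mapD(2)[OF f p] .
  have \<psi>fp: "\<psi> (f p) = f p" using semi[OF p] \<phi>p by simp
  define F where "F = disk_involution (f p) \<circ> f \<circ> disk_involution p"
  define \<Psi> where "\<Psi> = disk_involution (f p) \<circ> \<psi> \<circ> disk_involution (f p)"
  have F: "disk_self_map F" unfolding F_def by (rule disk_self_map_conjugate[OF f p])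
  have F0: "F 0 = 0" by (simp add: F_def)
  have \<Psi>: "disk_self_map \<Psi>"
    using disk_self_map_conjugate[OF assms(5) fp] \<psi>fp by (simp add: \<Psi>_def)
  have \<Psi>0: "\<Psi> 0 = 0" using \<psi>fp by (simp add: \<Psi>_def)
  have Fsemi: "F (lam * z) = \<Psi> (F z)" if z: "z \<in> unit_disk" for z
  proof -
    have w: "disk_involution p z \<in> unit_disk" using disk_involution_in_disk[OF p z] .
    show ?thesis
      using semi[OF w] \<phi>rot[OF z] disk_involution_involution[OF fp disk_self_mapD(2)[OF f w]]
      by (simp add: F_def \<Psi>_def)
  qed
  have LF: "linear_fractional f \<longleftrightarrow> linear_fractional F"
    unfolding F_def using linear_fractional_conjugate_iff[OF f p] by simp
  obtain H where n0: "1 \<le> n0"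
    and H: "H holomorphic_on unit_disk" "H 0 \<noteq> 0"
    and FH: "\<And>z. z \<in> unit_disk \<Longrightarrow> F z = z ^ n0 * H z"
    using conjugate_order_factorization[OF f assms(8) p assms(10)] unfolding F_def by metis
  have F_nonconst: "\<not> (\<forall>z\<in>unit_disk. F z = F 0)"
  proof
    assume const: "\<forall>z\<in>unit_disk. F z = F 0"
    have "H 0 = 0"
      by (rule holomorphic_eq_at_centre[where f = H and g = "\<lambda>_. 0"]) (use H const FH F0 in auto)
    then show False using H by simp
  qed
  have LF_n0: "n0 = 1" if "linear_fractional f"
    unfolding assms(10)
    by (rule Least_equality) (use linear_fractional_deriv_nonzero[OF that p] in auto)

  show ?thesis
  proof (intro conjI allI impI)
    assume id: "disk_identity \<psi>"
    have inv: "F (lam * z) = F z" if "z \<in> unit_disk" for z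
    proof -
      have "\<psi> (f (disk_involution p z)) = f (disk_involution p z)"
        using id disk_self_mapD(2)[OF f disk_involution_in_disk[OF p that]]
        by (simp add: disk_identity_def)
      then show ?thesis using Fsemi[OF that] disk_involution_involution[OF fp
            disk_self_mapD(2)[OF f disk_involution_in_disk[OF p that]]]
        by (simp add: F_def \<Psi>_def)
    qed
    show ex: "\<exists>n\<ge>1. lam ^ n = 1"
      using irrational_rotation_invariant_constant[OF disk_self_mapD(1)[OF F] lam inv] F_nonconst
      by blast
    note m0 = power_eq_one_iff_dvd_least[OF ex assms(11)]
    obtain g where g: "g holomorphic_on unit_disk" "\<And>z. z \<in> unit_disk \<Longrightarrow> F z = g (z ^ m0)"
      "g ` unit_disk = F ` unit_disk"
      using rotation_invariant_factors_through_power
        [OF disk_self_mapD(1)[OF F] lam inv m0(1,3)] by blast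
    show "\<exists>g. disk_self_map g \<and> \<not> g constant_on unit_disk \<and> g 0 = 0 \<and>
        (\<forall>z\<in>unit_disk. (disk_involution (f p) \<circ> f \<circ> disk_involution p) z = g (z ^ m0))"
    proof (intro exI conjI ballI)
      show "disk_self_map g" using g(1,3) F by (simp add: disk_self_map_def)
      show g0: "g 0 = 0" using g(2)[of 0] F0 m0(1) by (simp add: power_0_left)
      show "\<not> g constant_on unit_disk"
      proof
        assume "g constant_on unit_disk"
        then obtain c where c: "\<And>w. w \<in> unit_disk \<Longrightarrow> g w = c"
          unfolding constant_on_def by blast
        have "F z = c" if "z \<in> unit_disk" for z
          using g(2)[OF that] c[OF power_in_disk[OF that m0(1)]] by simp
        then show False using F_nonconst by simp
      qed
      show "(disk_involution (f p) \<circ> f \<circ> disk_involution p) z = g (z ^ m0)"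
        if "z \<in> unit_disk" for z using g(2)[OF that] by (simp add: F_def)
    qed
    show "\<not> linear_fractional f"
    proof
      assume lf: "linear_fractional f"
      \<comment> \<open>Otherwise invariance would annihilate the first Taylor coefficient of \<open>F\<close>.\<close>
      have "lam ^ 1 = 1"
      proof (rule ccontr)
        assume "lam ^ 1 \<noteq> 1"
        then have "deriv F 0 = 0"
          using rotation_invariant_coefficients[OF disk_self_mapD(1)[OF F] lam inv, of 1] by simp
        then show False using linear_fractional_deriv_nonzero[of F 0] lf LF by simp
      qed
      then show False using lam1 by simp
    qed
  next
    fix q \<mu> assume *: "\<not> disk_identity \<psi> \<and> denjoy_wolff_point \<psi> q \<and> \<mu> = deriv \<psi> q"
    then have ni: "\<not> disk_identity \<psi>" by blast
    have "elliptic \<psi>" using assms(5) ni fp \<psi>fp unfolding elliptic_def by blast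
    then have "q \<in> unit_disk" "\<psi> q = q" using * by (auto simp: denjoy_wolff_point_def)
    then have q: "q = f p" using unique_fixed_point[OF assms(5) ni _ _ fp \<psi>fp] by blast
    have \<mu>: "\<mu> = deriv \<psi> (f p)" using * q by simp
    have "deriv \<Psi> 0 = \<mu>"
      unfolding \<Psi>_def \<mu> by (rule deriv_conjugate_fixed_point[OF assms(5) fp \<psi>fp])
    then show mult: "lam ^ n0 = \<mu>"
      using semiconjugacy_multiplier[OF F H FH n0 disk_self_mapD(1)[OF \<Psi>] \<Psi>0 lam Fsemi] by simp
    then have \<mu>1: "norm \<mu> = 1" using lam by (metis norm_power power_one)
    \<comment> \<open>As \<open>\<mu>\<close> is unimodular, equality holds in the Schwarz lemma for \<open>\<psi>\<close> at its fixed point.\<close>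
    have \<Psi>rot: "\<Psi> w = \<mu> * w" if w: "w \<in> unit_disk" for w
    proof -
      have "\<psi> (disk_involution (f p) w) = disk_involution (f p) (\<mu> * w)"
        using rotation_at_fixed_point(2)[OF assms(5) fp \<psi>fp _ w] \<mu>1 \<mu> by simp
      moreover have "\<mu> * w \<in> unit_disk" using w \<mu>1 by (simp add: norm_mult)
      ultimately show ?thesis by (simp add: \<Psi>_def disk_involution_involution[OF fp])
    qed
    have Fmu: "F (lam * z) = lam ^ n0 * F z" if "z \<in> unit_disk" for z
      using Fsemi[OF that] \<Psi>rot[OF disk_self_mapD(2)[OF F that]] mult by simp
    have lam0: "lam \<noteq> 0" using lam by auto
    \<comment> \<open>The factor \<open>lam ^ n0\<close> is absorbed by the monomial.\<close>
    have inv: "H (lam * z) = H z" if z: "z \<in> unit_disk" for z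
    proof (cases "z = 0")
      case False
      have "(lam * z) ^ n0 * H (lam * z) = lam ^ n0 * (z ^ n0 * H z)"
        using Fmu[OF z] FH[OF z] FH[OF rot[OF z]] by simp
      then have "(lam * z) ^ n0 * H (lam * z) = (lam * z) ^ n0 * H z"
        by (simp add: power_mult_distrib mult_ac)
      then show ?thesis using False lam0 by simp
    qed simp
    have Hle: "norm (H z) \<le> 1" if "z \<in> unit_disk" for z
    proof (rule power_quotient_bound[OF H(1) _ that])
      show "norm (z ^ n0 * H z) \<le> 1" if "z \<in> unit_disk" for z
        using disk_self_mapD(2)[OF F that] FH[OF that] by simp
    qed
    have FH': "(disk_involution q \<circ> f \<circ> disk_involution p) z = z ^ n0 * H z"
      if "z \<in> unit_disk" for z using FH[OF that] by (simp add: F_def q)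
    have monomial_LF: "linear_fractional f"
      if const: "\<And>z. z \<in> unit_disk \<Longrightarrow> H z = H 0" and "n0 = 1"
    proof -
      have "F z = H 0 * z" if "z \<in> unit_disk" for z
        using FH[OF that] const[OF that] \<open>n0 = 1\<close> by simp
      then have "linear_fractional F"
        unfolding linear_fractional_def using H(2)
        by - (rule exI[of _ "H 0"], rule exI[of _ 0], rule exI[of _ 0], rule exI[of _ 1], simp)
      then show ?thesis using LF by simp
    qed
    show "\<exists>\<beta>\<in>cball 0 1 - {0}. \<forall>z\<in>unit_disk.
        (disk_involution q \<circ> f \<circ> disk_involution p) z = \<beta> * z ^ n0"
      if irr: "\<forall>n\<ge>1. lam ^ n \<noteq> 1"
    proof (intro bexI ballI)
      show "H 0 \<in> cball 0 1 - {0}" using H(2) Hle[of 0] by simp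
      fix z :: complex assume z: "z \<in> unit_disk"
      show "(disk_involution q \<circ> f \<circ> disk_involution p) z = H 0 * z ^ n0"
        using FH'[OF z] irrational_rotation_invariant_constant[OF H(1) lam inv irr z] by simp
    qed
    show "linear_fractional f \<longleftrightarrow> n0 = 1" if irr: "\<forall>n\<ge>1. lam ^ n \<noteq> 1"
      using LF_n0 monomial_LF irrational_rotation_invariant_constant[OF H(1) lam inv irr] by blast
    show "\<exists>g. (disk_self_map g \<or> (\<exists>c. norm c = 1 \<and> (\<forall>z\<in>unit_disk. g z = c))) \<and>
        (\<exists>z\<in>unit_disk. g z \<noteq> 0) \<and>
        (\<forall>z\<in>unit_disk.
           (disk_involution q \<circ> f \<circ> disk_involution p) z = z ^ n0 * g (z ^ m0)) \<and>
        (linear_fractional f \<longleftrightarrow> g constant_on unit_disk \<and> n0 = 1)"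
      if ex: "\<exists>n\<ge>1. lam ^ n = 1"
    proof -
      note m0 = power_eq_one_iff_dvd_least[OF ex assms(11)]
      obtain g where g: "g holomorphic_on unit_disk" "\<And>z. z \<in> unit_disk \<Longrightarrow> H z = g (z ^ m0)"
        "g ` unit_disk = H ` unit_disk"
        using rotation_invariant_factors_through_power[OF H(1) lam inv m0(1,3)] by blast
      have gle: "norm (g z) \<le> 1" if "z \<in> unit_disk" for z
      proof -
        have "g z \<in> H ` unit_disk" unfolding g(3)[symmetric] using that by (rule imageI)
        then obtain x where "g z = H x" "x \<in> unit_disk" by (rule imageE)
        then show ?thesis using Hle[of x] by simp
      qed
      have g0: "g 0 \<noteq> 0" using g(2)[of 0] H(2) m0(1) by (simp add: power_0_left)
      have LF_iff: "linear_fractional f \<longleftrightarrow> g constant_on unit_disk \<and> n0 = 1"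
      proof
        assume lf: "linear_fractional f"
        have n1: "n0 = 1" using LF_n0[OF lf] .
        have comm: "F (lam * z) = lam * F z" if "z \<in> unit_disk" for z
          using Fmu[OF that] n1 by simp
        have "linear_fractional F" using lf LF by simp
        then obtain k where k: "\<And>z. z \<in> unit_disk \<Longrightarrow> F z = k * z"
          using linear_fractional_commuting_rotation[OF _ F0 lam lam1 comm] by blast
        have off: "H z = k" if "z \<in> unit_disk" "z \<noteq> 0" for z
          using k[OF that(1)] FH[OF that(1)] n1 that(2) by simp
        have "H 0 = k"
          by (rule holomorphic_eq_at_centre[OF H(1) holomorphic_on_const off])
        then have "H z = k" if "z \<in> unit_disk" for z
          using off[OF that] by (cases "z = 0") auto
        then have "g ` unit_disk \<subseteq> {k}" unfolding g(3) by blast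
        then have "g constant_on unit_disk" unfolding constant_on_def by blast
        then show "g constant_on unit_disk \<and> n0 = 1" using n1 by blast
      next
        assume gc: "g constant_on unit_disk \<and> n0 = 1"
        then have "H z = H 0" if "z \<in> unit_disk" for z
        proof -
          obtain c where "\<And>w. w \<in> unit_disk \<Longrightarrow> g w = c"
            using gc unfolding constant_on_def by blast
          then have "H w = c" if "w \<in> unit_disk" for w
            using g(2)[OF that] power_in_disk[OF that m0(1)] by simp
          then show ?thesis using that by simp
        qed
        then show "linear_fractional f" using monomial_LF gc by blast
      qed
      have factor: "(disk_involution q \<circ> f \<circ> disk_involution p) z = z ^ n0 * g (z ^ m0)"
        if "z \<in> unit_disk" for z
        using FH'[OF that] g(2)[OF that] by (rule trans[OF _ arg_cong])
      show ?thesis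
      proof (intro exI[of _ g] conjI ballI)
        show "disk_self_map g \<or> (\<exists>c. norm c = 1 \<and> (\<forall>z\<in>unit_disk. g z = c))"
          by (rule bounded_by_one_dichotomy[OF g(1) gle])
        show "\<exists>z\<in>unit_disk. g z \<noteq> 0" using g0 by (intro bexI[of _ 0]) auto
      qed (fact factor, fact LF_iff)
    qed
  qed
qed

end
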